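(* Let $X$ be a real Banach space, let $\varphi: X\to[0,\infty)$ be a function, let $f: X\to(-\infty,\infty]$ have $\mathrm{dom}\,f\neq\emptyset$, and suppose that $(f\oplus\varphi)(x)>-\infty$ for all $x\in X$. Let $\varepsilon\ge0$. Given $\bar x\in X$, suppose that $\mathcal P(\bar x)$ is nonempty. Then $$\widehat\partial_\varepsilon(f\oplus\varphi)(\bar x)\subset\bigcap_{w\in\mathcal P(\bar x)}\Big(\widehat\partial_\varepsilon f(w)\cap\big[-\widehat\partial_\varepsilon\varphi(w-\bar x)\big]\Big).$$
   Context: $X^*$ is the dual of $X$ with pairing $\langle\cdot,\cdot\rangle$. $\mathrm{dom}\,f:=\{x\in X: f(x)<\infty\}$. The infimal convolution is $(f\oplus\varphi)(x):=\inf\{f(w)+\varphi(w-x): w\in X\}$ (note the argument $w-x$); under the standing assumptions it is real-valued. The projection at $x$ is $\mathcal P(x):=\{w\in X: f(w)+\varphi(w-x)=(f\oplus\varphi)(x)\}$. For $g:X\to(-\infty,\infty]$, $\varepsilon\ge0$ and $\bar x\in\mathrm{dom}\,g$, the $\varepsilon$-Fréchet subdifferential is $$\widehat\partial_\varepsilon g(\bar x):=\Big\{x^*\in X^*: \liminf_{x\to\bar x}\frac{g(x)-g(\bar x)-\langle x^*,x-\bar x\rangle}{\|x-\bar x\|}\ge-\varepsilon\Big\}.$$ For $A\subset X^*$, $-A:=\{-x^*:x^*\in A\}$. *)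

theory Defs
  imports "HOL-Analysis.Analysis"
begin

text \<open>
  Functions with values in \<open>(-\<infinity>,\<infinity>]\<close> are functions into \<^typ>\<open>ereal\<close> that avoid \<open>-\<infinity>\<close>.
  The dual of \<open>X\<close> is the type of bounded linear functionals \<open>X \<Rightarrow>\<^sub>L real\<close>, with pairing
  \<^const>\<open>blinfun_apply\<close>.
\<close>

definition eff_dom :: "('a \<Rightarrow> ereal) \<Rightarrow> 'a set" where
  "eff_dom f = {x. f x < \<infinity>}"

text \<open>The argument of \<open>\<phi>\<close> is \<open>w - x\<close>, not \<open>x - w\<close>; no symmetry of \<open>\<phi>\<close> is assumed.\<close>

definition inf_conv ::
    "('a::real_normed_vector \<Rightarrow> ereal) \<Rightarrow> ('a \<Rightarrow> real) \<Rightarrow> 'a \<Rightarrow> ereal" where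
  "inf_conv f \<phi> x = (INF w. f w + ereal (\<phi> (w - x)))"

definition proj ::
    "('a::real_normed_vector \<Rightarrow> ereal) \<Rightarrow> ('a \<Rightarrow> real) \<Rightarrow> 'a \<Rightarrow> 'a set" where
  "proj f \<phi> x = {w. f w + ereal (\<phi> (w - x)) = inf_conv f \<phi> x}"

text \<open>
  The subdifferential is only meaningful at points of the effective domain; it is
  empty elsewhere. For \<open>g > -\<infinity>\<close> and \<open>x\<close> in the domain, \<open>g x\<close> is finite, so no
  indeterminate \<^typ>\<open>ereal\<close> expression occurs. The filter \<open>at x\<close> excludes \<open>x\<close> itself.
\<close>

definition frechet_subdiff ::
    "real \<Rightarrow> ('a::real_normed_vector \<Rightarrow> ereal) \<Rightarrow> 'a \<Rightarrow> ('a \<Rightarrow>\<^sub>L real) set" where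
  "frechet_subdiff \<epsilon> g x =
    {x'. x \<in> eff_dom g \<and>
      Liminf (at x) (\<lambda>y. (g y - g x - ereal (blinfun_apply x' (y - x))) / ereal (norm (y - x)))
        \<ge> ereal (- \<epsilon>)}"

end

theory Submission
  imports Defs
begin

text \<open>
  Let \<open>F\<close> be the infimal convolution of \<open>f\<close> and \<open>\<phi>\<close>, and let \<open>w\<close> be a projection of \<open>xbar\<close>, so that
  \<open>F xbar = f w + \<phi> (w - xbar)\<close>. The point is that at \<open>w\<close> the infimum is attained, whereas at every
  other base point \<open>x\<close> any candidate gives an upper bound for \<open>F x\<close>. Two choices keep one of the two
  summands fixed and let the other vary: with \<open>x = xbar + (y - w)\<close> and candidate \<open>y\<close> the term
  \<open>\<phi> (w - xbar)\<close> cancels, and with \<open>x = w - u\<close> and candidate \<open>w\<close> the term \<open>f w\<close> cancels. Hence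
    \<open>F (xbar + (y - w)) - F xbar \<le> f y - f w\<close> and
    \<open>F (xbar - (u - (w - xbar))) - F xbar \<le> \<phi> u - \<phi> (w - xbar)\<close>.

  So the increments of \<open>f\<close> at \<open>w\<close> dominate those of \<open>F\<close> at \<open>xbar\<close>, and the increments of \<open>\<phi>\<close> at
  \<open>w - xbar\<close> dominate those of \<open>F\<close> at \<open>xbar\<close> in the reflected direction. Domination along a linear
  isometry transports \<open>\<epsilon>\<close>-subgradients (\<open>frechet_subdiff_transport\<close>); the reflection is what
  produces the minus sign in front of the subdifferential of \<open>\<phi>\<close>.
\<close>

lemma inf_conv_le: "inf_conv f \<phi> x \<le> f w + ereal (\<phi> (w - x))"
  unfolding inf_conv_def by (rule INF_lower) simp

text \<open>
  The norm in the difference quotient is unchanged by the isometry \<open>T\<close>, and \<open>y \<mapsto> a + T (y - b)\<close>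
  sends punctured neighbourhoods of \<open>b\<close> into punctured neighbourhoods of \<open>a\<close>. The quotient of \<open>g\<close> at
  \<open>b\<close> for \<open>x' \<circ> T\<close> is therefore bounded below by the quotient of \<open>F\<close> at \<open>a\<close> for \<open>x'\<close>, taken along this
  map.
\<close>

lemma frechet_subdiff_transport:
  fixes F :: "'a::real_normed_vector \<Rightarrow> ereal" and g :: "'b::real_normed_vector \<Rightarrow> ereal"
    and T :: "'b \<Rightarrow>\<^sub>L 'a"
  assumes x': "x' \<in> frechet_subdiff \<epsilon> F a"
    and isometry: "\<And>v. norm (T v) = norm v"
    and dom: "b \<in> eff_dom g"
    and increments: "\<And>y. F (a + T (y - b)) - F a \<le> g y - g b"
  shows "x' o\<^sub>L T \<in> frechet_subdiff \<epsilon> g b"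
proof -
  define Q where "Q = (\<lambda>x. (F x - F a - ereal (x' (x - a))) / ereal (norm (x - a)))"
  define R where "R = (\<lambda>y. (g y - g b - ereal ((x' o\<^sub>L T) (y - b))) / ereal (norm (y - b)))"
  have Q_liminf: "ereal (- \<epsilon>) \<le> Liminf (at a) Q"
    using x' unfolding frechet_subdiff_def Q_def by simp
  have T_nonzero: "T (y - b) \<noteq> 0" if "y \<noteq> b" for y
    using isometry[of "y - b"] that by auto
  have map_lim: "filterlim (\<lambda>y. a + T (y - b)) (at a) (at b)"
  proof (rule filterlim_atI)
    have "((\<lambda>y. a + T (y - b)) \<longlongrightarrow> a + T (b - b)) (at b)"
      by (intro tendsto_intros)
    then show "((\<lambda>y. a + T (y - b)) \<longlongrightarrow> a) (at b)"
      by (simp add: blinfun.zero_right)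
    show "\<forall>\<^sub>F y in at b. a + T (y - b) \<noteq> a"
      using T_nonzero by (auto simp: eventually_at_filter)
  qed
  have Q_le_R: "Q (a + T (y - b)) \<le> R y" if "y \<noteq> b" for y
  proof -
    have "0 < ereal (norm (y - b))"
      using that by simp
    moreover have "F (a + T (y - b)) - F a - ereal (x' (T (y - b)))
        \<le> g y - g b - ereal (x' (T (y - b)))"
      by (rule ereal_minus_mono[OF increments order_refl])
    ultimately show ?thesis
      unfolding Q_def R_def by (simp add: isometry ereal_divide_right_mono)
  qed
  have "ereal (- \<epsilon>) \<le> Liminf (at b) R"
    unfolding le_Liminf_iff
  proof (intro allI impI)
    fix c assume "c < ereal (- \<epsilon>)"
    then have "\<forall>\<^sub>F x in at a. c < Q x"
      using Q_liminf unfolding le_Liminf_iff by blast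
    then have "\<forall>\<^sub>F y in at b. c < Q (a + T (y - b))"
      by (rule eventually_compose_filterlim[OF _ map_lim])
    moreover have "\<forall>\<^sub>F y in at b. y \<noteq> b"
      by (simp add: eventually_at_filter)
    ultimately show "\<forall>\<^sub>F y in at b. c < R y"
      by eventually_elim (use Q_le_R in \<open>blast intro: less_le_trans\<close>)
  qed
  then show ?thesis
    using dom unfolding frechet_subdiff_def R_def by simp
qed

theorem proposition4p4:
  fixes f :: "'a::banach \<Rightarrow> ereal"
    and \<phi> :: "'a \<Rightarrow> real"
    and \<epsilon> :: real
    and xbar :: 'a
  assumes "\<And>x. \<phi> x \<ge> 0"
    and "\<And>x. f x \<noteq> -\<infinity>"
    and "eff_dom f \<noteq> {}"
    and "\<And>x. inf_conv f \<phi> x > -\<infinity>"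
    and "\<epsilon> \<ge> 0"
    and "proj f \<phi> xbar \<noteq> {}"
  shows "frechet_subdiff \<epsilon> (inf_conv f \<phi>) xbar
    \<subseteq> (\<Inter>w\<in>proj f \<phi> xbar.
          frechet_subdiff \<epsilon> f w
          \<inter> uminus ` frechet_subdiff \<epsilon> (\<lambda>u. ereal (\<phi> u)) (w - xbar))"
proof (intro subsetI INT_I IntI)
  fix x' w
  assume x': "x' \<in> frechet_subdiff \<epsilon> (inf_conv f \<phi>) xbar" and "w \<in> proj f \<phi> xbar"
  then have attained: "inf_conv f \<phi> xbar = f w + ereal (\<phi> (w - xbar))"
    by (simp add: proj_def)
  have "inf_conv f \<phi> xbar < \<infinity>"
    using x' by (simp add: frechet_subdiff_def eff_dom_def)
  then obtain r where r: "f w = ereal r"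
    using attained assms(2)[of w] by (cases "f w") auto

  have "inf_conv f \<phi> (xbar + id_blinfun (y - w)) - inf_conv f \<phi> xbar \<le> f y - f w" for y
    using inf_conv_le[of f \<phi> "xbar + (y - w)" y]
    unfolding attained r
    by (cases "f y"; cases "inf_conv f \<phi> (xbar + (y - w))") (auto simp: algebra_simps)
  then have "x' o\<^sub>L id_blinfun \<in> frechet_subdiff \<epsilon> f w"
    by (intro frechet_subdiff_transport[OF x']) (auto simp: eff_dom_def r)
  moreover have "x' o\<^sub>L id_blinfun = x'"
    by (rule blinfun_eqI) simp
  ultimately show "x' \<in> frechet_subdiff \<epsilon> f w"
    by simp

  have "inf_conv f \<phi> (xbar + (- id_blinfun) (u - (w - xbar))) - inf_conv f \<phi> xbar
      \<le> ereal (\<phi> u) - ereal (\<phi> (w - xbar))" for u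
    using inf_conv_le[of f \<phi> "w - u" w]
    unfolding attained r
    by (cases "inf_conv f \<phi> (w - u)") (auto simp: algebra_simps blinfun.minus_left)
  then have "x' o\<^sub>L (- id_blinfun) \<in> frechet_subdiff \<epsilon> (\<lambda>u. ereal (\<phi> u)) (w - xbar)"
    by (intro frechet_subdiff_transport[OF x']) (auto simp: eff_dom_def blinfun.minus_left)
  moreover have "x' o\<^sub>L (- id_blinfun) = - x'"
    by (rule blinfun_eqI) (simp add: blinfun.minus_left blinfun.minus_right)
  ultimately show "x' \<in> uminus ` frechet_subdiff \<epsilon> (\<lambda>u. ereal (\<phi> u)) (w - xbar)"
    by (intro image_eqI[where x = "- x'"]) auto
qed

end
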